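(* Let $N\ge 1$, $T>0$ and $c_0\in\mathbb{R}^N$. Assume $f\colon[0,T]\to\mathbb{R}$ is Lebesgue measurable, integrable, and has a Lebesgue point at $t=0$. Say that $c\colon[0,T]\to\mathbb{R}^N$ is a solution (in the extended sense) of the LegS ODE with initial value $c_0$ if $c$ is continuous on $[0,T]$, $c$ is absolutely continuous on $(0,T]$, $c$ satisfies $$c'(t)=-\frac1t A c(t)+\frac1t B f(t)$$ for almost all $t\in(0,T]$, and $c(0)=c_0$. Then: if $c_0=f(0)e_1$, where $e_1\in\mathbb{R}^N$ is the first standard basis vector, a solution exists and is unique; if $c_0\neq f(0)e_1$, no solution exists.
   Context: The matrix $A\in\mathbb{R}^{N\times N}$ and the vector $B\in\mathbb{R}^{N}$ are given, with indices $i,j\in\{1,\dots,N\}$, by $A_{ij}=(2i-1)^{1/2}(2j-1)^{1/2}$ if $i>j$, $A_{ii}=i$, $A_{ij}=0$ if $i<j$, and $B_j=(2j-1)^{1/2}$. A function $c\colon(0,T]\to\mathbb{R}^N$ is called absolutely continuous on $(0,T]$ if its restriction to $[\varepsilon,T]$ is absolutely continuous for every $\varepsilon\in(0,T)$. A measurable integrable $f\colon[0,T]\to\mathbb{R}$ has a Lebesgue point at $t=0$ if $\lim_{\varepsilon\to0^+}\frac1\varepsilon\int_0^\varepsilon|f(s)-f(0)|\,ds=0$. *)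

theory Defs
  imports "HOL-Analysis.Analysis"
begin

definition absolutely_continuous_on :: "real set \<Rightarrow> (real \<Rightarrow> 'a::real_normed_vector) \<Rightarrow> bool" where
  "absolutely_continuous_on S g \<longleftrightarrow>
     (\<forall>e>0. \<exists>d>0. \<forall>I :: (real \<times> real) set.
        finite I \<and>
        (\<forall>(u, v)\<in>I. u < v \<and> {u..v} \<subseteq> S) \<and>
        pairwise (\<lambda>p q. disjnt {fst p<..<snd p} {fst q<..<snd q}) I \<and>
        (\<Sum>(u, v)\<in>I. v - u) < d
        \<longrightarrow> (\<Sum>(u, v)\<in>I. norm (g v - g u)) < e)"

(* f is only given on [0,T] for some T > 0; the limit depends on f only near 0. *)
definition lebesgue_point_0 :: "(real \<Rightarrow> real) \<Rightarrow> bool" where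
  "lebesgue_point_0 f \<longleftrightarrow>
     ((\<lambda>\<epsilon>. (1 / \<epsilon>) * (LINT s|lebesgue_on {0..\<epsilon>}. \<bar>f s - f 0\<bar>)) \<longlongrightarrow> 0) (at_right 0)"

(* R^N is the type real^'n for a finite linearly ordered 'n with CARD('n) = N;
   idx is the order-preserving numbering of the coordinates by 1, ..., N. *)
definition idx :: "'n::{finite,linorder} \<Rightarrow> nat" where
  "idx i = card {j. j \<le> i}"

lemma strict_mono_idx: "strict_mono (idx :: 'n::{finite,linorder} \<Rightarrow> nat)"
proof (rule strict_monoI)
  fix i j :: 'n
  assume "i < j"
  then have "{k. k \<le> i} \<subseteq> {k. k \<le> j}" "j \<in> {k. k \<le> j}" "j \<notin> {k. k \<le> i}"
    by auto
  then have "{k. k \<le> i} \<subset> {k. k \<le> j}"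
    by blast
  then show "idx i < idx j"
    unfolding idx_def by (intro psubset_card_mono) auto
qed

lemma bij_betw_idx: "bij_betw (idx :: 'n::{finite,linorder} \<Rightarrow> nat) UNIV {1..CARD('n)}"
proof -
  have inj: "inj (idx :: 'n \<Rightarrow> nat)"
    by (rule strict_mono_imp_inj_on[OF strict_mono_idx])
  have "idx i \<in> {1..CARD('n)}" for i :: 'n
  proof -
    have "i \<in> {j. j \<le> i}" by simp
    then have "card {j. j \<le> i} > 0" by (subst card_gt_0_iff) auto
    then show ?thesis
      by (auto simp: idx_def Suc_le_eq intro: card_mono)
  qed
  then have "range (idx :: 'n \<Rightarrow> nat) \<subseteq> {1..CARD('n)}" by blast
  moreover have "card (range (idx :: 'n \<Rightarrow> nat)) = card {1..CARD('n)}"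
    using inj by (simp add: card_image)
  ultimately have "range (idx :: 'n \<Rightarrow> nat) = {1..CARD('n)}"
    by (intro card_subset_eq) auto
  with inj show ?thesis by (simp add: bij_betw_def)
qed

definition legs_A :: "real ^ 'n::{finite,linorder} ^ 'n::{finite,linorder}" where
  "legs_A = (\<chi> i j.
     if idx i > idx j then sqrt (2 * real (idx i) - 1) * sqrt (2 * real (idx j) - 1)
     else if idx i = idx j then real (idx i)
     else 0)"

definition legs_B :: "real ^ 'n::{finite,linorder}" where
  "legs_B = (\<chi> j. sqrt (2 * real (idx j) - 1))"

definition e1 :: "real ^ 'n::{finite,linorder}" where
  "e1 = (\<chi> j. if idx j = 1 then 1 else 0)"

(* Values of c outside [0,T] are irrelevant: the one-sided derivative at t = T concerns
   only a null set, and at 0 < t < T the derivative within [0,T] is the two-sided one. *)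
definition legs_solution ::
  "real \<Rightarrow> (real \<Rightarrow> real) \<Rightarrow> real ^ 'n::{finite,linorder} \<Rightarrow> (real \<Rightarrow> real ^ 'n::{finite,linorder}) \<Rightarrow> bool" where
  "legs_solution T f c0 c \<longleftrightarrow>
     continuous_on {0..T} c \<and>
     (\<forall>\<epsilon>\<in>{0<..<T}. absolutely_continuous_on {\<epsilon>..T} c) \<and>
     (AE t in lebesgue_on {0<..T}.
        (c has_vector_derivative
           - (1 / t) *\<^sub>R (legs_A *v c t) + (1 / t) *\<^sub>R (f t *\<^sub>R legs_B))
        (at t within {0..T})) \<and>
     c 0 = c0"

end

theory Submission
  imports Defs
begin

text \<open>
  The system is triangular. Its row with index \<open>k\<close> reads \<open>c\<^sub>k' = (h - k c\<^sub>k) / t\<close>, where \<open>h\<close>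
  is a multiple of \<open>f\<close> minus a linear combination of the components with smaller index. Hence
  everything reduces to the scalar singular equation \<open>u' = (h - k u) / t\<close> with \<open>k \<ge> 1\<close>, followed by
  induction on the row.

  Multiplication by \<open>t\<^sup>k\<close> turns the scalar equation into \<open>(t\<^sup>k u)' = t\<^sup>k\<^sup>-\<^sup>1 h\<close>. For a
  solution \<open>u\<close> the function \<open>t\<^sup>k u\<close> is absolutely continuous on \<open>[\<epsilon>, T]\<close>, so it is the integral of
  its derivative there. As \<open>u\<close> is bounded near \<open>0\<close>, the boundary term at \<open>\<epsilon>\<close> vanishes in the
  limit, which leaves \<open>t\<^sup>k u(t) = \<integral>\<^sub>0\<^sup>t s\<^sup>k\<^sup>-\<^sup>1 h(s) ds\<close> (\<open>singular_solution_integral\<close>): the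
  solution is unique, without any initial condition having been prescribed. Conversely, this formula
  defines a solution on \<open>(0, T]\<close>. If \<open>0\<close> is a Lebesgue point of \<open>h\<close>, the estimate
  \<open>\<bar>u(t) - h(0)/k\<bar> \<le> (1/t) \<integral>\<^sub>0\<^sup>t \<bar>h(s) - h(0)\<bar> ds\<close> shows that it extends continuously to \<open>0\<close> by
  the value \<open>h(0)/k\<close> (\<open>singular_solution_exists\<close>). The Lebesgue point is inherited by the right-hand
  side of each row, since the earlier components are continuous.

  Evaluating the rows at \<open>0\<close> one after another gives \<open>f(0)\<close> in the first row and \<open>0\<close> in all
  others (\<open>legs_row_at_0\<close>). So there is exactly one solution if the initial value is left free,
  and its initial value is \<open>f(0) e\<^sub>1\<close>; both halves of the theorem follow.

  Two facts from real analysis carry the argument: an absolutely continuous function that is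
  differentiable almost everywhere is the gauge integral of its derivative, and the indefinite
  integral of an integrable function is absolutely continuous with that function as its derivative
  almost everywhere.
\<close>

section \<open>Absolutely continuous functions\<close>

text \<open>
  A finite family of non-overlapping compact intervals in \<open>S\<close> of total length less than \<open>d\<close>, each
  interval being encoded as the pair of its end points. These are the families over which absolute
  continuity quantifies.
\<close>

definition disjoint_intervals :: "real set \<Rightarrow> real \<Rightarrow> (real \<times> real) set \<Rightarrow> bool" where
  "disjoint_intervals S d I \<longleftrightarrow> finite I \<and> (\<forall>(u, v)\<in>I. u < v \<and> {u..v} \<subseteq> S) \<and>
     pairwise (\<lambda>p q. disjnt {fst p<..<snd p} {fst q<..<snd q}) I \<and> (\<Sum>(u, v)\<in>I. v - u) < d"

lemma absolutely_continuous_on_iff: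
  "absolutely_continuous_on S g \<longleftrightarrow>
     (\<forall>e>0. \<exists>d>0. \<forall>I. disjoint_intervals S d I \<longrightarrow> (\<Sum>(u, v)\<in>I. norm (g v - g u)) < e)"
  unfolding absolutely_continuous_on_def disjoint_intervals_def by simp

lemma disjoint_intervalsD:
  assumes "disjoint_intervals S d I"
  shows "finite I" and "(u, v) \<in> I \<Longrightarrow> u < v" and "(u, v) \<in> I \<Longrightarrow> {u..v} \<subseteq> S"
    and "(u, v) \<in> I \<Longrightarrow> u \<in> S" and "(u, v) \<in> I \<Longrightarrow> v \<in> S"
    and "pairwise (\<lambda>p q. disjnt {fst p<..<snd p} {fst q<..<snd q}) I"
    and "(\<Sum>(u, v)\<in>I. v - u) < d"
proof -
  have *: "u < v \<and> {u..v} \<subseteq> S" if "(u, v) \<in> I" for u v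
    using assms that unfolding disjoint_intervals_def by blast
  show "(u, v) \<in> I \<Longrightarrow> u < v" "(u, v) \<in> I \<Longrightarrow> {u..v} \<subseteq> S" using * by auto
  show "(u, v) \<in> I \<Longrightarrow> u \<in> S" "(u, v) \<in> I \<Longrightarrow> v \<in> S" using *[of u v] by auto
qed (use assms in \<open>auto simp: disjoint_intervals_def\<close>)

lemma disjoint_intervals_mono:
  assumes "disjoint_intervals S d I" "S \<subseteq> S'" "d \<le> d'"
  shows "disjoint_intervals S' d' I"
  using assms unfolding disjoint_intervals_def by fastforce

text \<open>
  The one closure principle needed: a function whose increments are bounded by those of finitely many
  absolutely continuous functions is absolutely continuous. Restriction to a smaller set, Lipschitz
  functions, products and vectors of functions are all instances.
\<close>

lemma absolutely_continuous_on_dominated: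
  fixes f :: "real \<Rightarrow> 'a::real_normed_vector" and g :: "'i \<Rightarrow> real \<Rightarrow> 'b::real_normed_vector"
  assumes "finite J" and ac: "\<And>j. j \<in> J \<Longrightarrow> absolutely_continuous_on S (g j)"
    and "S' \<subseteq> S" and "C \<ge> 0"
    and le: "\<And>u v. \<lbrakk>u \<in> S'; v \<in> S'\<rbrakk> \<Longrightarrow> norm (f v - f u) \<le> C * (\<Sum>j\<in>J. norm (g j v - g j u))"
  shows "absolutely_continuous_on S' f"
  unfolding absolutely_continuous_on_iff
proof (intro allI impI)
  fix e :: real assume "e > 0"
  \<comment> \<open>The added ones avoid division by zero when \<open>C = 0\<close> or \<open>J = {}\<close>.\<close>
  define e' where "e' = e / ((C + 1) * (real (card J) + 1))"
  have "e' > 0" unfolding e'_def using \<open>e > 0\<close> \<open>C \<ge> 0\<close> by (intro divide_pos_pos mult_pos_pos) auto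
  have "\<forall>j\<in>J. \<exists>d>0. \<forall>I. disjoint_intervals S d I \<longrightarrow> (\<Sum>(u, v)\<in>I. norm (g j v - g j u)) < e'"
    using ac \<open>e' > 0\<close> unfolding absolutely_continuous_on_iff by blast
  then obtain d where d: "\<And>j. j \<in> J \<Longrightarrow> d j > 0"
    and dI: "\<And>j I. \<lbrakk>j \<in> J; disjoint_intervals S (d j) I\<rbrakk> \<Longrightarrow> (\<Sum>(u, v)\<in>I. norm (g j v - g j u)) < e'"
    by metis
  define D where "D = Min (insert 1 (d ` J))"
  have "D > 0" using d \<open>finite J\<close> by (auto simp: D_def)
  have D: "D \<le> d j" if "j \<in> J" for j
    using that \<open>finite J\<close> by (auto simp: D_def)
  show "\<exists>d>0. \<forall>I. disjoint_intervals S' d I \<longrightarrow> (\<Sum>(u, v)\<in>I. norm (f v - f u)) < e"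
  proof (intro exI[of _ D] conjI allI impI \<open>D > 0\<close>)
    fix I assume I: "disjoint_intervals S' D I"
    have "(\<Sum>(u, v)\<in>I. norm (f v - f u)) \<le> (\<Sum>(u, v)\<in>I. C * (\<Sum>j\<in>J. norm (g j v - g j u)))"
      using disjoint_intervalsD(4,5)[OF I] by (intro sum_mono) (auto intro!: le)
    also have "\<dots> = C * (\<Sum>j\<in>J. \<Sum>(u, v)\<in>I. norm (g j v - g j u))"
      unfolding case_prod_beta by (subst sum.swap) (simp add: sum_distrib_left)
    also have "\<dots> \<le> C * (\<Sum>j\<in>J. e')"
    proof (rule mult_left_mono[OF sum_mono \<open>C \<ge> 0\<close>])
      fix j assume "j \<in> J"
      have "disjoint_intervals S (d j) I"
        using I \<open>S' \<subseteq> S\<close> D[OF \<open>j \<in> J\<close>] by (rule disjoint_intervals_mono)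
      then show "(\<Sum>(u, v)\<in>I. norm (g j v - g j u)) \<le> e'"
        using dI[OF \<open>j \<in> J\<close>] by (simp add: less_imp_le)
    qed
    also have "\<dots> < e"
    proof -
      have "C * real (card J) < (C + 1) * (real (card J) + 1)"
        using \<open>C \<ge> 0\<close> by (simp add: algebra_simps add_pos_nonneg)
      then have "C * real (card J) * e' < (C + 1) * (real (card J) + 1) * e'"
        using \<open>e' > 0\<close> by (rule mult_strict_right_mono)
      also have "\<dots> = e" using \<open>C \<ge> 0\<close> by (simp add: e'_def)
      finally show ?thesis by (simp add: mult.assoc)
    qed
    finally show "(\<Sum>(u, v)\<in>I. norm (f v - f u)) < e" .
  qed
qed

lemma absolutely_continuous_on_subset_cong:
  assumes "absolutely_continuous_on S f" "T \<subseteq> S" "\<And>x. x \<in> T \<Longrightarrow> g x = f x"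
  shows "absolutely_continuous_on T g"
  by (rule absolutely_continuous_on_dominated[of "{()}" S "\<lambda>_. f" _ 1]) (use assms in auto)

lemma absolutely_continuous_on_ident: "absolutely_continuous_on S (\<lambda>x. x)"
  unfolding absolutely_continuous_on_iff
proof (intro allI impI)
  fix e :: real assume "e > 0"
  have "(\<Sum>(u, v)\<in>I. norm (v - u)) < e" if I: "disjoint_intervals S e I" for I
  proof -
    have "(\<Sum>(u, v)\<in>I. norm (v - u)) = (\<Sum>(u, v)\<in>I. v - u)"
      using disjoint_intervalsD(2)[OF I] by (intro sum.cong) (auto simp: less_imp_le)
    then show ?thesis using disjoint_intervalsD(7)[OF I] by simp
  qed
  then show "\<exists>d>0. \<forall>I. disjoint_intervals S d I \<longrightarrow> (\<Sum>(u, v)\<in>I. norm (v - u)) < e"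
    using \<open>e > 0\<close> by blast
qed

lemma absolutely_continuous_on_lipschitz:
  assumes "C-lipschitz_on S f"
  shows "absolutely_continuous_on S f"
proof (rule absolutely_continuous_on_dominated[of "{()}" S "\<lambda>_ x. x" S C])
  show "norm (f v - f u) \<le> C * (\<Sum>j\<in>{()}. norm (v - u))" if "u \<in> S" "v \<in> S" for u v
    using lipschitz_onD[OF assms that(2,1)] by (simp add: dist_norm)
qed (auto simp: absolutely_continuous_on_ident lipschitz_on_nonneg[OF assms])

lemma absolutely_continuous_on_continuous_derivative:
  fixes p p' :: "real \<Rightarrow> real"
  assumes "\<And>x. x \<in> {a..b} \<Longrightarrow> (p has_real_derivative p' x) (at x within {a..b})"
    and "continuous_on {a..b} p'"
  shows "absolutely_continuous_on {a..b} p"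
proof -
  obtain B where B: "B > 0" "\<And>x. x \<in> {a..b} \<Longrightarrow> norm (p' x) \<le> B"
    using compact_imp_bounded[OF compact_continuous_image[OF assms(2) compact_Icc]] unfolding bounded_pos by auto
  have "B-lipschitz_on {a..b} p"
  proof (rule bounded_derivative_imp_lipschitz)
    show "(p has_derivative (\<lambda>h. h * p' x)) (at x within {a..b})" if "x \<in> {a..b}" for x
      using assms(1)[OF that] unfolding has_field_derivative_def by (simp add: mult_commute_abs)
    show "onorm (\<lambda>h. h * p' x) \<le> B" if "x \<in> {a..b}" for x
    proof (rule onorm_le)
      show "norm (h * p' x) \<le> B * norm h" for h
        using mult_right_mono[OF B(2)[OF that], of "norm h"] by (simp add: abs_mult mult.commute)
    qed
  qed (use B in auto)
  then show ?thesis by (rule absolutely_continuous_on_lipschitz)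
qed

lemma absolutely_continuous_on_mult:
  fixes f g :: "real \<Rightarrow> real"
  assumes f: "absolutely_continuous_on S f" and g: "absolutely_continuous_on S g"
    and "bounded (f ` S)" "bounded (g ` S)"
  shows "absolutely_continuous_on S (\<lambda>x. f x * g x)"
proof -
  obtain B1 B2 where B: "B1 > 0" "\<And>x. x \<in> S \<Longrightarrow> norm (f x) \<le> B1" "B2 > 0" "\<And>x. x \<in> S \<Longrightarrow> norm (g x) \<le> B2"
    using assms(3,4) unfolding bounded_pos by auto
  show ?thesis
  proof (rule absolutely_continuous_on_dominated[of UNIV S "\<lambda>b. if b then f else g" S "B1 + B2"])
    fix u v assume uv: "u \<in> S" "v \<in> S"
    have "norm (f v * g v - f u * g u) = norm (f v * (g v - g u) + (f v - f u) * g u)"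
      by (simp add: algebra_simps)
    also have "\<dots> \<le> norm (f v) * norm (g v - g u) + norm (f v - f u) * norm (g u)"
      by (metis norm_mult norm_triangle_ineq)
    also have "\<dots> \<le> B1 * norm (g v - g u) + norm (f v - f u) * B2"
      using B uv by (intro add_mono mult_right_mono mult_left_mono) auto
    also have "\<dots> \<le> (B1 + B2) * (norm (f v - f u) + norm (g v - g u))"
      using B by (simp add: algebra_simps)
    finally show "norm (f v * g v - f u * g u)
        \<le> (B1 + B2) * (\<Sum>j\<in>UNIV. norm ((if j then f else g) v - (if j then f else g) u))"
      by (simp add: UNIV_bool algebra_simps)
  qed (use f g B in auto)
qed

lemma absolutely_continuous_on_vec_iff:
  fixes c :: "real \<Rightarrow> real ^ 'n"
  shows "absolutely_continuous_on S c \<longleftrightarrow> (\<forall>i. absolutely_continuous_on S (\<lambda>t. c t $ i))"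
proof (intro iffI allI)
  fix i assume c: "absolutely_continuous_on S c"
  have le: "norm (c v $ i - c u $ i) \<le> norm (c v - c u)" for u v
    by (metis vector_minus_component Finite_Cartesian_Product.norm_nth_le)
  show "absolutely_continuous_on S (\<lambda>t. c t $ i)"
    by (rule absolutely_continuous_on_dominated[of "{()}" S "\<lambda>_. c" S 1]) (use c le in auto)
next
  assume c: "\<forall>i. absolutely_continuous_on S (\<lambda>t. c t $ i)"
  have le: "norm (c v - c u) \<le> 1 * (\<Sum>i\<in>UNIV. norm (c v $ i - c u $ i))" for u v
    using norm_le_l1_cart[of "c v - c u"] by simp
  show "absolutely_continuous_on S c"
    by (rule absolutely_continuous_on_dominated[of UNIV S "\<lambda>i t. c t $ i" S 1]) (use c le in auto)
qed

section \<open>Absolute continuity, derivatives and integrals\<close>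

text \<open>
  Used twice below, with \<open>r = 1\<close> to bound the total length of intervals inside a small open set, and
  with \<open>r\<close> the tail of a truncated integrable function.
\<close>

lemma sum_integral_disjoint_intervals_le:
  fixes r :: "real \<Rightarrow> real"
  assumes "finite I" and I: "\<And>u v. (u, v) \<in> I \<Longrightarrow> u < v \<and> {u<..<v} \<subseteq> S"
    and disj: "pairwise (\<lambda>p q. disjnt {fst p<..<snd p} {fst q<..<snd q}) I"
    and r: "r integrable_on S" "\<And>x. x \<in> S \<Longrightarrow> r x \<ge> 0"
  shows "(\<Sum>(u, v)\<in>I. integral {u..v} r) \<le> integral S r"
proof -
  have abs: "r absolutely_integrable_on S"
    using r by (simp add: nonnegative_absolutely_integrable_1)
  have int: "r integrable_on {u<..<v}" if "(u, v) \<in> I" for u v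
  proof -
    have "r absolutely_integrable_on {u<..<v}"
      using set_integrable_subset[OF abs _ conjunct2[OF I[OF that]]] by simp
    then show ?thesis by (simp add: set_lebesgue_integral_eq_integral)
  qed
  have hi: "(r has_integral (\<Sum>p\<in>I. integral {fst p<..<snd p} r)) (\<Union>p\<in>I. {fst p<..<snd p})"
  proof (rule has_integral_UN[OF \<open>finite I\<close>])
    show "(r has_integral integral {fst p<..<snd p} r) {fst p<..<snd p}" if "p \<in> I" for p
      using int[of "fst p" "snd p"] that by (simp add: has_integral_integrable_integral)
    show "pairwise (\<lambda>i i'. negligible ({fst i<..<snd i} \<inter> {fst i'<..<snd i'})) I"
      using disj by (rule pairwise_mono) (auto simp: disjnt_def)
  qed
  have "(\<Sum>(u, v)\<in>I. integral {u..v} r) = (\<Sum>p\<in>I. integral {fst p<..<snd p} r)"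
    by (simp add: case_prod_beta integral_open_interval_real)
  also have "\<dots> = integral (\<Union>p\<in>I. {fst p<..<snd p}) r"
    using hi by (simp add: integral_unique)
  also have "\<dots> \<le> integral S r"
    using hi r I by (intro integral_subset_le) fastforce+
  finally show ?thesis .
qed

text \<open>
  The integrand is split as a part bounded by a constant \<open>n\<close>, which contributes at most \<open>n\<close> times the
  total length, and a tail \<open>r\<close> of small integral.
\<close>

lemma absolutely_continuous_on_indefinite_integral:
  fixes g :: "real \<Rightarrow> real"
  assumes g: "g absolutely_integrable_on {a..b}"
  shows "absolutely_continuous_on {a..b} (\<lambda>t. integral {a..t} g)"
  unfolding absolutely_continuous_on_iff
proof (intro allI impI)
  fix e :: real assume "e > 0"
  define m where "m n x = min \<bar>g x\<bar> (real n)" for n x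
  have absg: "(\<lambda>x. \<bar>g x\<bar>) absolutely_integrable_on {a..b}"
    using set_integrable_abs[OF g] .
  have m: "m n absolutely_integrable_on {a..b}" for n
  proof -
    have "(\<lambda>x. real n) absolutely_integrable_on {a..b}" by simp
    from absolutely_integrable_min_1[OF absg this] show ?thesis by (simp add: m_def[abs_def])
  qed
  have "(\<lambda>n. integral {a..b} (m n)) \<longlonglongrightarrow> integral {a..b} (\<lambda>x. \<bar>g x\<bar>)"
  proof (rule dominated_convergence(2))
    show "m n integrable_on {a..b}" for n
      using m by (simp add: set_lebesgue_integral_eq_integral)
    show "(\<lambda>x. \<bar>g x\<bar>) integrable_on {a..b}"
      using absg by (simp add: set_lebesgue_integral_eq_integral)
    show "norm (m n x) \<le> \<bar>g x\<bar>" for n x by (simp add: m_def)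
    show "(\<lambda>n. m n x) \<longlonglongrightarrow> \<bar>g x\<bar>" for x
    proof (rule tendsto_eventually)
      have "m n x = \<bar>g x\<bar>" if "n \<ge> nat \<lceil>\<bar>g x\<bar>\<rceil>" for n
        using that unfolding m_def by linarith
      then show "\<forall>\<^sub>F n in sequentially. m n x = \<bar>g x\<bar>"
        unfolding eventually_sequentially by blast
    qed
  qed
  then have "\<forall>\<^sub>F n in sequentially. integral {a..b} (m n) > integral {a..b} (\<lambda>x. \<bar>g x\<bar>) - e / 2"
    using \<open>e > 0\<close> by (intro order_tendstoD) auto
  then obtain n where n: "integral {a..b} (m n) > integral {a..b} (\<lambda>x. \<bar>g x\<bar>) - e / 2"
    by (meson eventually_happens' sequentially_bot)
  define r where "r x = \<bar>g x\<bar> - m n x" for x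
  have r: "r absolutely_integrable_on {a..b}"
    unfolding r_def[abs_def] using absg m by (rule set_integral_diff(1))
  have r_nonneg: "r x \<ge> 0" for x by (simp add: r_def m_def)
  have r_int: "integral {a..b} r < e / 2"
    unfolding r_def[abs_def] using n absg m
    by (subst integral_diff) (simp_all add: set_lebesgue_integral_eq_integral)
  define d where "d = e / (2 * (real n + 1))"
  have "d > 0" using \<open>e > 0\<close> by (simp add: d_def)
  show "\<exists>d>0. \<forall>I. disjoint_intervals {a..b} d I \<longrightarrow>
      (\<Sum>(u, v)\<in>I. norm (integral {a..v} g - integral {a..u} g)) < e"
  proof (intro exI[of _ d] conjI allI impI \<open>d > 0\<close>)
    fix I assume I: "disjoint_intervals {a..b} d I"
    note I' = disjoint_intervalsD[OF I]
    have "(\<Sum>(u, v)\<in>I. norm (integral {a..v} g - integral {a..u} g))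
        \<le> (\<Sum>(u, v)\<in>I. real n * (v - u) + integral {u..v} r)"
    proof (intro sum_mono, clarify)
      fix u v assume uv: "(u, v) \<in> I"
      then have "u < v" and sub: "{u..v} \<subseteq> {a..b}" by (auto dest: I'(2,3))
      then have le: "a \<le> u" "v \<le> b" by auto
      have gab: "g integrable_on {a..b}" using g by (simp add: set_lebesgue_integral_eq_integral)
      have gi: "g integrable_on {u..v}"
        using gab sub integrable_on_subinterval by blast
      have ri: "r integrable_on {u..v}"
        using r sub by (metis integrable_on_subinterval set_lebesgue_integral_eq_integral(1))
      have "integral {a..u} g + integral {u..v} g = integral {a..v} g"
        using gab le \<open>u < v\<close> by (intro Henstock_Kurzweil_Integration.integral_combine) (auto intro: integrable_on_subinterval)
      then have "norm (integral {a..v} g - integral {a..u} g) = norm (integral {u..v} g)"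
        by (simp add: algebra_simps)
      also have "\<dots> \<le> integral {u..v} (\<lambda>x. real n + r x)"
        using integrable_add[OF integrable_const_ivl[of "real n" u v] ri] gi
        by (intro integral_norm_bound_integral) (auto simp: r_def m_def)
      also have "\<dots> = real n * (v - u) + integral {u..v} r"
        using ri \<open>u < v\<close> by (subst integral_add) auto
      finally show "norm (integral {a..v} g - integral {a..u} g) \<le> real n * (v - u) + integral {u..v} r" .
    qed
    also have "\<dots> = real n * (\<Sum>(u, v)\<in>I. v - u) + (\<Sum>(u, v)\<in>I. integral {u..v} r)"
      by (simp add: case_prod_beta sum.distrib sum_distrib_left)
    also have "\<dots> \<le> real n * d + integral {a..b} r"
    proof (intro add_mono mult_left_mono sum_integral_disjoint_intervals_le)
      show "u < v \<and> {u<..<v} \<subseteq> {a..b}" if "(u, v) \<in> I" for u v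
        using I'(2,3)[OF that] greaterThanLessThan_subseteq_atLeastAtMost_iff by fastforce
    qed (use I'(1,6,7) r r_nonneg in \<open>auto simp: set_lebesgue_integral_eq_integral\<close>)
    also have "\<dots> < e / 2 + e / 2"
      using \<open>e > 0\<close> by (intro add_le_less_mono r_int) (simp add: d_def field_simps)
    finally show "(\<Sum>(u, v)\<in>I. norm (integral {a..v} g - integral {a..u} g)) < e" by simp
  qed
qed

text \<open>
  The proof follows that of the fundamental theorem for the gauge integral. Tags outside the exceptional
  set \<open>N\<close> are controlled by differentiability. For tags in \<open>N\<close> the gauge forces the intervals into an
  open superset of \<open>N\<close> of small measure, and absolute continuity makes the sum of the increments of \<open>F\<close>
  over them small.
\<close>

theorem fundamental_theorem_of_calculus_absolutely_continuous:
  fixes F :: "real \<Rightarrow> 'a::banach"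
  assumes "a \<le> b" and ac: "absolutely_continuous_on {a..b} F" and "negligible N"
    and deriv: "\<And>x. x \<in> {a..b} - N \<Longrightarrow> (F has_vector_derivative f x) (at x within {a..b})"
  shows "(f has_integral (F b - F a)) {a..b}"
proof -
  define f0 where "f0 x = (if x \<in> N then 0 else f x)" for x
  have "(f0 has_integral (F b - F a)) (cbox a b)"
    unfolding has_integral
  proof (intro allI impI)
    fix e :: real assume "e > 0"
    \<comment> \<open>Twice \<open>\<eta> * (b - a)\<close> stays below \<open>e\<close>; adding \<open>1\<close> covers the case \<open>a = b\<close>.\<close>
    define \<eta> where "\<eta> = e / (2 * (b - a + 1))"
    have "\<eta> > 0" using \<open>e > 0\<close> \<open>a \<le> b\<close> by (simp add: \<eta>_def)
    obtain \<delta> where "\<delta> > 0" and \<delta>: "\<And>I. disjoint_intervals {a..b} \<delta> I \<Longrightarrow> (\<Sum>(u, v)\<in>I. norm (F v - F u)) < e / 2"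
      using ac \<open>e > 0\<close> unfolding absolutely_continuous_on_iff by (metis half_gt_zero)
    obtain U where "open U" "N \<subseteq> U" and U: "U - N \<in> lmeasurable" "emeasure lebesgue (U - N) < ennreal \<delta>"
      using sets_lebesgue_outer_open[OF negligible_imp_sets[OF \<open>negligible N\<close>] \<open>\<delta> > 0\<close>] by metis
    have "N \<union> (U - N) \<in> lmeasurable"
      using U(1) negligible_imp_measurable[OF \<open>negligible N\<close>] by (rule fmeasurable.Un[rotated])
    then have U_meas: "U \<in> lmeasurable" using \<open>N \<subseteq> U\<close> by (simp add: Un_absorb1)
    have "measure lebesgue U = measure lebesgue (U - N)"
      using \<open>negligible N\<close> by (simp add: measure_Diff_null_set negligible_iff_null_sets fmeasurableD U_meas)
    also have "\<dots> < \<delta>"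
      using U \<open>\<delta> > 0\<close> by (metis emeasure_eq_measure2 ennreal_less_iff measure_nonneg)
    finally have U_small: "measure lebesgue U < \<delta>" .
    have "\<forall>x. \<exists>d>0. x \<in> {a..b} - N \<longrightarrow>
         (\<forall>y\<in>{a..b}. norm (y-x) < d \<longrightarrow> norm (F y - F x - (y-x) *\<^sub>R f x) \<le> \<eta> * norm (y-x))"
      using deriv[unfolded has_vector_derivative_def has_derivative_within_alt] \<open>\<eta> > 0\<close>
      by (metis zero_less_one)
    then obtain d where d_pos: "\<And>x. 0 < d x"
      and d: "\<And>x y. \<lbrakk>x \<in> {a..b} - N; y \<in> {a..b}; norm (y-x) < d x\<rbrakk>
                        \<Longrightarrow> norm (F y - F x - (y-x) *\<^sub>R f x) \<le> \<eta> * norm (y-x)"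
      by metis
    define \<gamma> where "\<gamma> x = (if x \<in> N then U else ball x (d x))" for x
    have gauge: "gauge \<gamma>"
      using \<open>open U\<close> \<open>N \<subseteq> U\<close> d_pos by (auto simp: gauge_def \<gamma>_def)
    have close: "norm ((\<Sum>(x, K)\<in>p. measure lborel K *\<^sub>R f0 x) - (F b - F a)) < e"
      if ptag: "p tagged_division_of (cbox a b)" and fine: "\<gamma> fine p" for p
    proof -
      note p = tagged_division_ofD[OF ptag]
      have K: "\<exists>u v. K = {u..v} \<and> u \<le> x \<and> x \<le> v \<and> a \<le> u \<and> v \<le> b" if "(x, K) \<in> p" for x K
      proof -
        obtain u v where uv: "K = cbox u v" using p(4)[OF \<open>(x, K) \<in> p\<close>] by blast
        have "x \<in> K" "K \<subseteq> cbox a b" using p(2,3)[OF \<open>(x, K) \<in> p\<close>] by auto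
        then show ?thesis using uv by (intro exI[of _ u] exI[of _ v]) auto
      qed
      \<comment> \<open>The nondegenerate intervals with tag in \<open>N\<close>. Degenerate ones contribute no increment, and
        leaving them out makes the passage to end points injective.\<close>
      define V where "V = (\<lambda>(x, K). (Inf K, Sup K)) ` {(x, K) \<in> p. x \<in> N \<and> Inf K < Sup K}"
      have inj: "inj_on (\<lambda>(x, K). (Inf K, Sup K)) {(x, K) \<in> p. x \<in> N \<and> Inf K < Sup K}"
      proof (rule inj_onI, clarify)
        fix x K x' K'
        assume A: "(x, K) \<in> p" "(x', K') \<in> p" "Inf K < Sup K" "Inf K = Inf K'" "Sup K = Sup K'"
        obtain u v where uv: "K = {u..v}" "u \<le> v" using K[OF A(1)] by fastforce
        obtain u' v' where uv': "K' = {u'..v'}" "u' \<le> v'" using K[OF A(2)] by fastforce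
        have "K = K'" "interior K \<noteq> {}" using A uv uv' by auto
        then show "x = x' \<and> K = K'" using p(5)[OF A(1,2)] by auto
      qed
      have V: "u < v \<and> {u<..<v} \<subseteq> U \<and> {u..v} \<subseteq> {a..b}" if "(u, v) \<in> V" for u v
      proof -
        obtain x K where xK: "(x, K) \<in> p" "x \<in> N" "u = Inf K" "v = Sup K" "u < v"
          using \<open>(u, v) \<in> V\<close> by (auto simp: V_def)
        obtain u' v' where uv: "K = {u'..v'}" "u' \<le> v'" using K[OF xK(1)] by fastforce
        have "K \<subseteq> U" using fineD[OF fine xK(1)] xK(2) by (simp add: \<gamma>_def)
        then show ?thesis using xK uv p(3)[OF xK(1)] by auto
      qed
      have V_disj: "pairwise (\<lambda>p q. disjnt {fst p<..<snd p} {fst q<..<snd q}) V"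
      proof (rule pairwiseI)
        fix i j assume "i \<in> V" "j \<in> V" "i \<noteq> j"
        obtain x K where xK: "(x, K) \<in> p" "i = (Inf K, Sup K)" using \<open>i \<in> V\<close> by (auto simp: V_def)
        obtain y L where yL: "(y, L) \<in> p" "j = (Inf L, Sup L)" using \<open>j \<in> V\<close> by (auto simp: V_def)
        obtain u v where uv: "K = {u..v}" "u \<le> v" using K[OF xK(1)] by fastforce
        obtain u' v' where uv': "L = {u'..v'}" "u' \<le> v'" using K[OF yL(1)] by fastforce
        have "interior K \<inter> interior L = {}" using p(5)[OF xK(1) yL(1)] xK yL \<open>i \<noteq> j\<close> by auto
        then show "disjnt {fst i<..<snd i} {fst j<..<snd j}"
          using xK yL uv uv' by (simp add: disjnt_def)
      qed
      have V_fin: "finite V" using p(1) unfolding V_def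
        by (intro finite_imageI finite_subset[OF _ p(1)]) auto
      have "(\<Sum>(u, v)\<in>V. v - u) = (\<Sum>(u, v)\<in>V. integral {u..v} (\<lambda>_. 1))"
        using V by (intro sum.cong) (auto simp: less_imp_le)
      also have "\<dots> \<le> integral U (\<lambda>_. 1)"
        using V V_fin V_disj U_meas by (intro sum_integral_disjoint_intervals_le) (auto simp: integrable_on_const)
      also have "\<dots> < \<delta>"
        using U_meas U_small by (simp add: lmeasure_integral)
      finally have "disjoint_intervals {a..b} \<delta> V"
        using V V_fin V_disj by (auto simp: disjoint_intervals_def)
      then have V_sum: "(\<Sum>(u, v)\<in>V. norm (F v - F u)) < e / 2" by (rule \<delta>)

      define t where "t = (\<lambda>(x, K). measure lborel K *\<^sub>R f0 x - (F (Sup K) - F (Inf K)))"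
      define s where "s = (\<lambda>(x, K). if x \<in> N \<and> Inf K < Sup K then norm (F (Sup K) - F (Inf K)) else 0)"
      have t_le: "norm (t (x, K)) \<le> \<eta> * measure lborel K + s (x, K)" if xK: "(x, K) \<in> p" for x K
      proof -
        obtain u v where uv: "K = {u..v}" "u \<le> x" "x \<le> v" "a \<le> u" "v \<le> b" using K[OF xK] by blast
        then have IS: "Inf K = u" "Sup K = v" "measure lborel K = v - u" by auto
        show ?thesis
        proof (cases "x \<in> N")
          case True
          have "u < v \<or> u = v" using uv by auto
          then show ?thesis using True IS \<open>\<eta> > 0\<close> by (auto simp: t_def s_def f0_def norm_minus_commute)
        next
          case False
          then have "x \<in> {a..b} - N" using uv by auto
          have "K \<subseteq> ball x (d x)" using fineD[OF fine xK] False by (simp add: \<gamma>_def)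
          moreover have "u \<in> K" "v \<in> K" using uv by auto
          ultimately have "u \<in> ball x (d x)" "v \<in> ball x (d x)" by blast+
          then have "norm (F u - F x - (u-x) *\<^sub>R f x) \<le> \<eta> * norm (u-x)"
            and "norm (F v - F x - (v-x) *\<^sub>R f x) \<le> \<eta> * norm (v-x)"
            using uv d[OF \<open>x \<in> {a..b} - N\<close>, of u] d[OF \<open>x \<in> {a..b} - N\<close>, of v]
            by (simp_all add: dist_real_def)
          moreover have "t (x, K) = (F u - F x - (u-x) *\<^sub>R f x) - (F v - F x - (v-x) *\<^sub>R f x)"
          proof -
            have "t (x, K) = (v - u) *\<^sub>R f x - (F v - F u)"
              using False by (simp only: t_def f0_def IS prod.case if_False)
            then show ?thesis by (simp add: scaleR_left_diff_distrib)
          qed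
          ultimately have "norm (t (x, K)) \<le> \<eta> * norm (u-x) + \<eta> * norm (v-x)"
            by (smt (verit) norm_triangle_ineq4)
          also have "\<dots> = \<eta> * (v - u)" using uv by (simp add: algebra_simps)
          also have "\<dots> = \<eta> * measure lborel K" by (simp only: IS)
          finally show ?thesis using False by (simp add: s_def)
        qed
      qed
      have "(\<Sum>(x, K)\<in>p. measure lborel K *\<^sub>R f0 x) - (F b - F a) = (\<Sum>i\<in>p. t i)"
        using additive_tagged_division_1[OF \<open>a \<le> b\<close>, of p F] ptag
        by (simp add: t_def case_prod_beta sum_subtractf)
      also have "norm \<dots> \<le> (\<Sum>i\<in>p. \<eta> * measure lborel (snd i) + s i)"
        using t_le by (intro sum_norm_le) auto
      also have "\<dots> = \<eta> * (\<Sum>(x, K)\<in>p. measure lborel K) + (\<Sum>i\<in>p. s i)"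
        by (simp add: sum.distrib sum_distrib_left case_prod_beta)
      also have "(\<Sum>(x, K)\<in>p. measure lborel K) = b - a"
        using additive_content_tagged_division[OF ptag] \<open>a \<le> b\<close> by simp
      also have "(\<Sum>i\<in>p. s i) = (\<Sum>(u, v)\<in>V. norm (F v - F u))"
      proof -
        have "{(x, K) \<in> p. x \<in> N \<and> Inf K < Sup K} = {i \<in> p. fst i \<in> N \<and> Inf (snd i) < Sup (snd i)}"
          by auto
        then show ?thesis
          unfolding V_def sum.reindex[OF inj] s_def
          using p(1) by (simp add: case_prod_beta comp_def sum.inter_filter)
      qed
      also have "\<eta> * (b - a) + (\<Sum>(u, v)\<in>V. norm (F v - F u)) < e / 2 + e / 2"
      proof (intro add_le_less_mono V_sum)
        have "\<eta> * (b - a) \<le> \<eta> * (b - a + 1)" using \<open>\<eta> > 0\<close> by simp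
        also have "\<dots> = e / 2" using \<open>a \<le> b\<close> by (simp add: \<eta>_def field_simps)
        finally show "\<eta> * (b - a) \<le> e / 2" .
      qed
      finally show ?thesis by simp
    qed
    show "\<exists>\<gamma>. gauge \<gamma> \<and> (\<forall>\<D>. \<D> tagged_division_of (cbox a b) \<and> \<gamma> fine \<D> \<longrightarrow>
        norm ((\<Sum>(x, K)\<in>\<D>. measure lborel K *\<^sub>R f0 x) - (F b - F a)) < e)"
      by (intro exI[of _ \<gamma>] conjI allI impI gauge) (elim conjE, rule close)
  qed
  then have "(f0 has_integral (F b - F a)) {a..b}" by simp
  then show ?thesis
    by (rule has_integral_spike[OF \<open>negligible N\<close>, rotated]) (auto simp: f0_def)
qed

text \<open>
  Lebesgue differentiation in one dimension. The theorem \<open>integrable_ccontinuous_explicit\<close> treats the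
  right-hand difference quotients; the left-hand ones are obtained by applying it to the reflected function.
\<close>

theorem indefinite_integral_has_vector_derivative_ae:
  fixes f :: "real \<Rightarrow> real"
  assumes f: "f integrable_on {a..b}"
  obtains N where "negligible N"
    "\<And>x. x \<in> {a..b} - N \<Longrightarrow> ((\<lambda>t. integral {a..t} f) has_vector_derivative f x) (at x within {a..b})"
proof -
  define g where "g x = (if x \<in> {a..b} then f x else 0)" for x
  have g: "g integrable_on {c..d}" for c d
  proof -
    have "g integrable_on UNIV"
      unfolding g_def using f by (simp only: integrable_restrict_UNIV)
    then show ?thesis using integrable_on_subinterval by blast
  qed
  have g': "(\<lambda>x. g (- x)) integrable_on {c..d}" for c d
    using g[of "-d" "-c"] Henstock_Kurzweil_Integration.integrable_reflect_real[where f=g and a="-d" and b="-c"] by simp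
  obtain N1 where N1: "negligible N1"
    "\<And>x e. \<lbrakk>x \<notin> N1; 0 < e\<rbrakk> \<Longrightarrow> \<exists>d>0. \<forall>h. 0 < h \<and> h < d \<longrightarrow> \<bar>integral {x..x + h} g / h - g x\<bar> < e"
    using integrable_ccontinuous_explicit[of g] g
    by (auto simp: divide_inverse_commute)
  obtain N2 where N2: "negligible N2"
    "\<And>x e. \<lbrakk>x \<notin> N2; 0 < e\<rbrakk> \<Longrightarrow> \<exists>d>0. \<forall>h. 0 < h \<and> h < d \<longrightarrow> \<bar>integral {x..x + h} (\<lambda>x. g (- x)) / h - g (- x)\<bar> < e"
    using integrable_ccontinuous_explicit[of "\<lambda>x. g (- x)"] g'
    by (auto simp: divide_inverse_commute)
  have "negligible (N1 \<union> uminus ` N2)"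
    using N1(1) N2(1) by (intro negligible_Un negligible_differentiable_image_negligible) (auto intro!: differentiable_on_minus)
  moreover have "((\<lambda>t. integral {a..t} f) has_vector_derivative f x) (at x within {a..b})"
    if x: "x \<in> {a..b} - (N1 \<union> uminus ` N2)" for x
    unfolding has_vector_derivative_def has_derivative_within_alt
  proof (intro conjI allI impI)
    show "bounded_linear (\<lambda>h. h *\<^sub>R f x)" by (rule bounded_linear_scaleR_left)
    fix e :: real assume "e > 0"
    have "x \<notin> N1" "- x \<notin> N2" using x by (auto simp: image_iff)
    \<comment> \<open>Right-hand difference quotients at \<open>x\<close> from \<open>g\<close>, left-hand ones from the reflected function at \<open>- x\<close>.\<close>
    obtain d1 where "d1 > 0" and d1: "\<And>h. \<lbrakk>0 < h; h < d1\<rbrakk> \<Longrightarrow> \<bar>integral {x..x + h} g / h - g x\<bar> < e"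
      using N1(2)[OF \<open>x \<notin> N1\<close> \<open>e > 0\<close>] by blast
    obtain d2 where "d2 > 0" and d2: "\<And>h. \<lbrakk>0 < h; h < d2\<rbrakk> \<Longrightarrow>
        \<bar>integral {- x..- x + h} (\<lambda>x. g (- x)) / h - g x\<bar> < e"
      using N2(2)[OF \<open>- x \<notin> N2\<close> \<open>e > 0\<close>] by auto
    have split: "integral {a..v} f - integral {a..u} f = integral {u..v} g" if "a \<le> u" "u \<le> v" "v \<le> b" for u v
    proof -
      have "integral {a..u} f + integral {u..v} f = integral {a..v} f"
        using f that by (intro Henstock_Kurzweil_Integration.integral_combine) (auto intro: integrable_on_subinterval)
      moreover have "integral {u..v} f = integral {u..v} g"
        using that by (intro integral_cong) (auto simp: g_def)
      ultimately show ?thesis by simp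
    qed
    have clear_denom: "\<bar>i - h * c\<bar> \<le> e * h" if "h > 0" "\<bar>i / h - c\<bar> < e" for i h c :: real
    proof -
      have "i / h - c = (i - h * c) / h" using that by (simp add: field_simps)
      then show ?thesis using that by (simp add: abs_divide pos_divide_less_eq)
    qed
    have gx: "g x = f x" using x by (simp add: g_def)
    have "norm (integral {a..y} f - integral {a..x} f - (y - x) *\<^sub>R f x) \<le> e * norm (y - x)"
      if y: "y \<in> {a..b}" "norm (y - x) < min d1 d2" for y
    proof (cases y x rule: linorder_cases)
      case greater
      have "\<bar>integral {x..y} g / (y - x) - f x\<bar> < e"
        using d1[of "y - x"] greater y gx by simp
      then have "\<bar>integral {x..y} g - (y - x) * f x\<bar> \<le> e * (y - x)"
        using greater by (intro clear_denom) auto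
      then show ?thesis
        using split[of x y] x y greater by simp
    next
      case less
      have "\<bar>integral {y..x} g / (x - y) - f x\<bar> < e"
        using d2[of "x - y"] less y gx Henstock_Kurzweil_Integration.integral_reflect_real[where f=g and a=y and b=x] by simp
      then have "\<bar>integral {y..x} g - (x - y) * f x\<bar> \<le> e * (x - y)"
        using less by (intro clear_denom) auto
      moreover have "integral {a..y} f - integral {a..x} f - (y - x) * f x = - (integral {y..x} g - (x - y) * f x)"
        using split[of y x] x y less by (simp add: algebra_simps)
      ultimately show ?thesis
        using less by (simp add: abs_minus_commute)
    qed simp
    then show "\<exists>d>0. \<forall>y\<in>{a..b}. norm (y - x) < d \<longrightarrow>
        norm (integral {a..y} f - integral {a..x} f - (y - x) *\<^sub>R f x) \<le> e * norm (y - x)"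
      using \<open>d1 > 0\<close> \<open>d2 > 0\<close> by (intro exI[of _ "min d1 d2"]) auto
  qed
  ultimately show ?thesis by (rule that)
qed

section \<open>Lebesgue points at the origin\<close>

text \<open>
  For integrable \<open>h\<close> the defining averages are gauge integrals, for which the rest of the argument is
  formulated.
\<close>

lemma lebesgue_point_0_integral:
  assumes T: "T > 0" and h: "h absolutely_integrable_on {0..T}"
  shows "lebesgue_point_0 h \<longleftrightarrow>
    ((\<lambda>t. integral {0..t} (\<lambda>s. \<bar>h s - h 0\<bar>) / t) \<longlongrightarrow> 0) (at_right 0)"
  unfolding lebesgue_point_0_def
proof (rule tendsto_cong)
  have "\<forall>\<^sub>F t in at_right 0. t \<in> {0<..<T}"
    using T by (rule eventually_at_right_real)
  then show "\<forall>\<^sub>F t in at_right 0. 1 / t * (LINT s|lebesgue_on {0..t}. \<bar>h s - h 0\<bar>)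
      = integral {0..t} (\<lambda>s. \<bar>h s - h 0\<bar>) / t"
  proof eventually_elim
    case (elim t)
    have "h absolutely_integrable_on {0..t}"
      using absolutely_integrable_on_subinterval[OF h] elim by simp
    then have "(\<lambda>s. \<bar>h s - h 0\<bar>) absolutely_integrable_on {0..t}"
      by (intro set_integrable_abs set_integral_diff(1)) auto
    then have "integrable (lebesgue_on {0..t}) (\<lambda>s. \<bar>h s - h 0\<bar>)"
      by (intro absolutely_integrable_imp_integrable) auto
    then show ?case by (simp add: lebesgue_integral_eq_integral)
  qed
qed

lemma lebesgue_point_0_continuous:
  assumes T: "T > 0" and g: "continuous_on {0..T} g"
  shows "lebesgue_point_0 g"
proof -
  have absg: "g absolutely_integrable_on {0..T}"
    using g by (rule absolutely_integrable_continuous_real)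
  show ?thesis
    unfolding lebesgue_point_0_integral[OF T absg]
  proof (rule tendstoI)
    fix e :: real assume "e > 0"
    obtain d where "d > 0" and d: "\<And>s. \<lbrakk>s \<in> {0..T}; \<bar>s\<bar> < d\<rbrakk> \<Longrightarrow> \<bar>g s - g 0\<bar> < e / 2"
      using g \<open>e > 0\<close> T unfolding continuous_on_iff
      by (metis atLeastAtMost_iff diff_zero dist_real_def half_gt_zero less_eq_real_def order_refl)
    have "\<forall>\<^sub>F t in at_right 0. t \<in> {0<..<min d T}"
      using T \<open>d > 0\<close> by (intro eventually_at_right_real) simp
    then show "\<forall>\<^sub>F t in at_right 0. dist (integral {0..t} (\<lambda>s. \<bar>g s - g 0\<bar>) / t) 0 < e"
    proof eventually_elim
      case (elim t)
      have "continuous_on {0..t} (\<lambda>s. \<bar>g s - g 0\<bar>)"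
        using elim by (intro continuous_intros continuous_on_subset[OF g]) auto
      then have int: "(\<lambda>s. \<bar>g s - g 0\<bar>) integrable_on {0..t}"
        by (rule integrable_continuous_real)
      have "norm (integral {0..t} (\<lambda>s. \<bar>g s - g 0\<bar>)) \<le> integral {0..t} (\<lambda>s. e / 2)"
        using elim d int by (intro integral_norm_bound_integral) (auto simp: less_imp_le)
      also have "\<dots> = t * (e / 2)" using elim by simp
      also have "\<dots> < t * e" using elim \<open>e > 0\<close> by simp
      finally show ?case
        using elim by (simp add: dist_real_def pos_divide_less_eq mult.commute)
    qed
  qed
qed

lemma lebesgue_point_0_linear_combination:
  assumes T: "T > 0" and f: "f absolutely_integrable_on {0..T}" "lebesgue_point_0 f"
    and g: "g absolutely_integrable_on {0..T}" "lebesgue_point_0 g"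
  shows "lebesgue_point_0 (\<lambda>t. a * f t - g t)"
proof -
  let ?m = "\<lambda>h t. integral {0..t} (\<lambda>s. \<bar>h s - h 0\<bar>) / t"
  have af: "(\<lambda>t. a * f t - g t) absolutely_integrable_on {0..T}"
    using f g by (intro set_integral_diff(1) set_integrable_mult_right)
  have bound: "((\<lambda>t. \<bar>a\<bar> * ?m f t + ?m g t) \<longlongrightarrow> \<bar>a\<bar> * 0 + 0) (at_right 0)"
    using f g unfolding lebesgue_point_0_integral[OF T f(1)] lebesgue_point_0_integral[OF T g(1)]
    by (intro tendsto_intros)
  have in_T: "\<forall>\<^sub>F t in at_right 0. t \<in> {0<..<T}"
    using T by (rule eventually_at_right_real)
  have "(?m (\<lambda>t. a * f t - g t) \<longlongrightarrow> 0) (at_right 0)"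
  proof (rule Lim_null_comparison[OF eventually_mono[OF in_T]])
    show "((\<lambda>t. \<bar>a\<bar> * ?m f t + ?m g t) \<longlongrightarrow> 0) (at_right 0)" using bound by simp
    fix t assume t: "t \<in> {0<..<T}"
    have int: "(\<lambda>s. \<bar>h s - h 0\<bar>) integrable_on {0..t}" if "h absolutely_integrable_on {0..T}" for h :: "real \<Rightarrow> real"
    proof -
      have "h absolutely_integrable_on {0..t}"
        using absolutely_integrable_on_subinterval[OF that] t by simp
      then have "(\<lambda>s. \<bar>h s - h 0\<bar>) absolutely_integrable_on {0..t}"
        by (intro set_integrable_abs set_integral_diff(1)) auto
      then show ?thesis by (rule set_lebesgue_integral_eq_integral)
    qed
    have "norm (integral {0..t} (\<lambda>s. \<bar>(a * f s - g s) - (a * f 0 - g 0)\<bar>))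
        \<le> integral {0..t} (\<lambda>s. \<bar>a\<bar> * \<bar>f s - f 0\<bar> + \<bar>g s - g 0\<bar>)"
    proof (rule integral_norm_bound_integral)
      show "(\<lambda>s. \<bar>a\<bar> * \<bar>f s - f 0\<bar> + \<bar>g s - g 0\<bar>) integrable_on {0..t}"
        by (intro integrable_add integrable_on_mult_right int f g)
      show "norm \<bar>(a * f s - g s) - (a * f 0 - g 0)\<bar> \<le> \<bar>a\<bar> * \<bar>f s - f 0\<bar> + \<bar>g s - g 0\<bar>" for s
      proof -
        have "\<bar>(a * f s - g s) - (a * f 0 - g 0)\<bar> = \<bar>a * (f s - f 0) - (g s - g 0)\<bar>"
          by (simp add: algebra_simps)
        also have "\<dots> \<le> \<bar>a * (f s - f 0)\<bar> + \<bar>g s - g 0\<bar>" by (rule abs_triangle_ineq4)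
        finally show ?thesis by (simp add: abs_mult)
      qed
    qed (rule int[OF af])
    also have "\<dots> = \<bar>a\<bar> * integral {0..t} (\<lambda>s. \<bar>f s - f 0\<bar>) + integral {0..t} (\<lambda>s. \<bar>g s - g 0\<bar>)"
      by (subst integral_add) (auto intro!: integrable_on_mult_right int f g)
    finally show "norm (?m (\<lambda>t. a * f t - g t) t) \<le> \<bar>a\<bar> * ?m f t + ?m g t"
      using t by (simp add: abs_divide divide_simps mult.commute)
  qed
  then show ?thesis unfolding lebesgue_point_0_integral[OF T af] .
qed

section \<open>The scalar singular equation\<close>

lemma absolutely_integrable_power_mult:
  fixes h :: "real \<Rightarrow> real"
  assumes h: "h absolutely_integrable_on {a..b}"
  shows "(\<lambda>s. s ^ m * h s) absolutely_integrable_on {a..b}"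
proof (rule absolutely_integrable_bounded_measurable_product_real[OF _ _ _ h])
  have "continuous_on {a..b} (\<lambda>s::real. s ^ m)" by (intro continuous_intros)
  then show "(\<lambda>s. s ^ m) \<in> borel_measurable (lebesgue_on {a..b})"
    "bounded ((\<lambda>s. s ^ m) ` {a..b})"
    by (simp_all add: continuous_imp_measurable_on_sets_lebesgue compact_imp_bounded compact_continuous_image)
qed simp

text \<open>
  Continuous solutions on \<open>[0,T]\<close> of \<open>u' = (h - k u) / t\<close>, in the sense of the system: absolutely
  continuous away from \<open>0\<close>, with the equation holding almost everywhere on \<open>(0,T]\<close>. No initial value
  is part of the notion, as the equation determines it.
\<close>

definition singular_solution :: "real \<Rightarrow> nat \<Rightarrow> (real \<Rightarrow> real) \<Rightarrow> (real \<Rightarrow> real) \<Rightarrow> bool" where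
  "singular_solution T k h u \<longleftrightarrow>
     continuous_on {0..T} u \<and>
     (\<forall>\<epsilon>\<in>{0<..<T}. absolutely_continuous_on {\<epsilon>..T} u) \<and>
     negligible {t \<in> {0<..T}. \<not> (u has_vector_derivative (h t - real k * u t) / t) (at t within {0..T})}"

text \<open>
  The equation integrated: the factor \<open>t\<^sup>k\<close> kills the unknown boundary term at \<open>0\<close>, as \<open>k \<ge> 1\<close>.
\<close>

lemma singular_solution_integral:
  assumes sol: "singular_solution T k h u" and "k \<ge> 1"
    and h: "h absolutely_integrable_on {0..T}" and t: "0 < t" "t \<le> T"
  shows "t ^ k * u t = integral {0..t} (\<lambda>s. s ^ (k - 1) * h s)"
proof -
  define w where "w s = s ^ (k - 1) * h s" for s
  define N where "N = {t \<in> {0<..T}. \<not> (u has_vector_derivative (h t - real k * u t) / t) (at t within {0..T})}"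
  have N: "negligible N" and u_cont: "continuous_on {0..T} u"
    and u_ac: "\<And>\<epsilon>. \<epsilon> \<in> {0<..<T} \<Longrightarrow> absolutely_continuous_on {\<epsilon>..T} u"
    using sol by (auto simp: singular_solution_def N_def)
  have w: "w integrable_on {0..T}"
    unfolding w_def[abs_def] using absolutely_integrable_power_mult[OF h] by (rule set_lebesgue_integral_eq_integral)
  have eq: "t ^ k * u t - \<epsilon> ^ k * u \<epsilon> = integral {0..t} w - integral {0..\<epsilon>} w" if \<epsilon>: "\<epsilon> \<in> {0<..<t}" for \<epsilon>
  proof -
    have sub: "{\<epsilon>..t} \<subseteq> {0..T}" using \<epsilon> t by auto
    have "absolutely_continuous_on {\<epsilon>..t} u"
      using \<epsilon> t by (intro absolutely_continuous_on_subset_cong[OF u_ac[of \<epsilon>]]) auto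
    moreover have "absolutely_continuous_on {\<epsilon>..t} (\<lambda>s. s ^ k)"
      by (rule absolutely_continuous_on_continuous_derivative[where p' = "\<lambda>s. real k * s ^ (k - 1)"])
         (auto intro!: derivative_eq_intros continuous_intros)
    moreover have "bounded (u ` {\<epsilon>..t})" "bounded ((\<lambda>s. s ^ k) ` {\<epsilon>..t})"
      using continuous_on_subset[OF u_cont sub]
      by (auto intro!: compact_imp_bounded compact_continuous_image continuous_intros)
    ultimately have ac: "absolutely_continuous_on {\<epsilon>..t} (\<lambda>s. s ^ k * u s)"
      by (intro absolutely_continuous_on_mult)
    have "(w has_integral (t ^ k * u t - \<epsilon> ^ k * u \<epsilon>)) {\<epsilon>..t}"
    proof (rule fundamental_theorem_of_calculus_absolutely_continuous[OF _ ac N])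
      fix x assume x: "x \<in> {\<epsilon>..t} - N"
      have "(u has_vector_derivative (h x - real k * u x) / x) (at x within {0..T})"
        using x \<epsilon> t by (auto simp: N_def)
      then have "(u has_vector_derivative (h x - real k * u x) / x) (at x within {\<epsilon>..t})"
        using sub by (rule has_vector_derivative_within_subset)
      then have "(u has_real_derivative (h x - real k * u x) / x) (at x within {\<epsilon>..t})"
        by (simp add: has_real_derivative_iff_has_vector_derivative)
      then have "((\<lambda>s. s ^ k * u s) has_real_derivative
          real k * x ^ (k - 1) * u x + (h x - real k * u x) / x * x ^ k) (at x within {\<epsilon>..t})"
        by (auto intro!: derivative_eq_intros)
      moreover have "x ^ k = x * x ^ (k - 1)"
        using \<open>k \<ge> 1\<close> by (simp flip: power_Suc)
      then have "y / x * x ^ k = y * x ^ (k - 1)" for y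
        using x \<epsilon> by simp
      then have "real k * x ^ (k - 1) * u x + (h x - real k * u x) / x * x ^ k = w x"
        by (simp only: w_def) (simp add: algebra_simps)
      ultimately show "((\<lambda>s. s ^ k * u s) has_vector_derivative w x) (at x within {\<epsilon>..t})"
        by (simp add: has_real_derivative_iff_has_vector_derivative)
    qed (use \<epsilon> in auto)
    moreover have "integral {0..\<epsilon>} w + integral {\<epsilon>..t} w = integral {0..t} w"
      using \<epsilon> t by (intro Henstock_Kurzweil_Integration.integral_combine integrable_on_subinterval[OF w]) auto
    ultimately show ?thesis by (simp add: integral_unique algebra_simps)
  qed
  have in_t: "\<forall>\<^sub>F \<epsilon> in at_right 0. \<epsilon> \<in> {0<..<t}"
    using t by (intro eventually_at_right_real)
  \<comment> \<open>Both sides of the identity above are continuous in \<open>\<epsilon>\<close> up to \<open>0\<close>.\<close>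
  have lim_right: "(v \<longlongrightarrow> v 0) (at_right 0)" if "continuous_on {0..T} v" for v :: "real \<Rightarrow> real"
    using that t by (simp add: continuous_on_Icc_at_rightD)
  have "((\<lambda>\<epsilon>. t ^ k * u t - \<epsilon> ^ k * u \<epsilon>) \<longlongrightarrow> t ^ k * u t - 0 ^ k * u 0) (at_right 0)"
    using lim_right[OF u_cont] by (intro tendsto_intros)
  moreover have "((\<lambda>\<epsilon>. integral {0..t} w - integral {0..\<epsilon>} w) \<longlongrightarrow> integral {0..t} w - integral {0..0} w) (at_right 0)"
    using lim_right[OF indefinite_integral_continuous_1[OF w]] by (intro tendsto_intros)
  then have "((\<lambda>\<epsilon>. t ^ k * u t - \<epsilon> ^ k * u \<epsilon>) \<longlongrightarrow> integral {0..t} w - integral {0..0} w) (at_right 0)"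
    by (rule Lim_transform_eventually) (use in_t in \<open>eventually_elim, simp add: eq\<close>)
  ultimately have "t ^ k * u t - 0 ^ k * u 0 = integral {0..t} w - integral {0..0} w"
    by (intro tendsto_unique[OF trivial_limit_at_right_real])
  then show ?thesis using \<open>k \<ge> 1\<close> by (simp add: w_def[abs_def] power_0_left)
qed

lemma singular_solution_unique:
  assumes T: "T > 0" and "k \<ge> 1" and h: "h absolutely_integrable_on {0..T}"
    and eq: "\<And>s. s \<in> {0..T} \<Longrightarrow> h s = h' s"
    and u: "singular_solution T k h u" and v: "singular_solution T k h' v"
    and t: "t \<in> {0..T}"
  shows "u t = v t"
proof -
  have h': "h' absolutely_integrable_on {0..T}"
    using absolutely_integrable_spike[OF h negligible_empty] eq by simp
  have pos: "u t = v t" if t: "0 < t" "t \<le> T" for t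
  proof -
    have "t ^ k * u t = t ^ k * v t"
      unfolding singular_solution_integral[OF u \<open>k \<ge> 1\<close> h t] singular_solution_integral[OF v \<open>k \<ge> 1\<close> h' t]
      using t eq by (intro integral_cong) auto
    then show ?thesis using t by simp
  qed
  have uv: "continuous_on {0..T} u" "continuous_on {0..T} v"
    using u v by (auto simp: singular_solution_def)
  \<comment> \<open>The equation says nothing at \<open>0\<close>, where the values agree by continuity.\<close>
  have "(u \<longlongrightarrow> v 0) (at_right 0)"
    using continuous_on_Icc_at_rightD[OF uv(2) T]
  proof (rule Lim_transform_eventually)
    show "\<forall>\<^sub>F t in at_right 0. v t = u t"
      using eventually_at_right_real[OF T] by eventually_elim (simp add: pos)
  qed
  then have "u 0 = v 0"
    using continuous_on_Icc_at_rightD[OF uv(1) T] by (intro tendsto_unique[OF trivial_limit_at_right_real])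
  then show ?thesis using pos[of t] t by (cases "t = 0") auto
qed

lemma singular_solution_exists:
  assumes T: "T > 0" and "k \<ge> 1" and h: "h absolutely_integrable_on {0..T}" and lp: "lebesgue_point_0 h"
  obtains u where "singular_solution T k h u" "u 0 = h 0 / real k"
proof -
  define w where "w s = s ^ (k - 1) * h s" for s
  define G where "G t = integral {0..t} w" for t
  define u where "u t = (if t = 0 then h 0 / real k else G t * inverse (t ^ k))" for t
  have power_k: "x ^ k = x * x ^ (k - 1)" for x :: real
    using \<open>k \<ge> 1\<close> by (simp flip: power_Suc)
  have w_abs: "w absolutely_integrable_on {0..T}"
    unfolding w_def[abs_def] using h by (rule absolutely_integrable_power_mult)
  then have w: "w integrable_on {0..T}" by (rule set_lebesgue_integral_eq_integral)
  have G_cont: "continuous_on {0..T} G"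
    unfolding G_def[abs_def] using w by (rule indefinite_integral_continuous_1)
  have G_ac: "absolutely_continuous_on {0..T} G"
    unfolding G_def[abs_def] using w_abs by (rule absolutely_continuous_on_indefinite_integral)
  obtain N where N: "negligible N"
    and G_deriv: "\<And>x. x \<in> {0..T} - N \<Longrightarrow> (G has_vector_derivative w x) (at x within {0..T})"
    unfolding G_def[abs_def] using indefinite_integral_has_vector_derivative_ae[OF w] by blast

  have "(u \<longlongrightarrow> u 0) (at_right 0)"
  proof -
    have "((\<lambda>t. u t - u 0) \<longlongrightarrow> 0) (at_right 0)"
    proof (rule Lim_null_comparison[OF eventually_mono[OF eventually_at_right_real[OF T]]])
      show "((\<lambda>t. integral {0..t} (\<lambda>s. \<bar>h s - h 0\<bar>) / t) \<longlongrightarrow> 0) (at_right 0)"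
        using lp lebesgue_point_0_integral[OF T h] by simp
      fix t assume t: "t \<in> {0<..<T}"
      have h_t: "h absolutely_integrable_on {0..t}"
        using absolutely_integrable_on_subinterval[OF h] t by simp
      then have diff: "(\<lambda>s. h s - h 0) absolutely_integrable_on {0..t}"
        by (intro set_integral_diff(1)) auto
      have w_t: "w integrable_on {0..t}" using t by (intro integrable_on_subinterval[OF w]) auto
      \<comment> \<open>Since \<open>\<integral>\<^sub>0\<^sup>t s\<^sup>k\<^sup>-\<^sup>1 ds = t\<^sup>k / k\<close>,
        the difference \<open>u t - u 0\<close> is \<open>t\<^sup>-\<^sup>k\<close> times the integral of \<open>s\<^sup>k\<^sup>-\<^sup>1 (h s - h 0)\<close>.\<close>
      have "((\<lambda>s. s ^ (k - 1)) has_integral (t ^ k / real k - 0 ^ k / real k)) {0..t}"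
        using t \<open>k \<ge> 1\<close>
        by (intro fundamental_theorem_of_calculus)
           (auto intro!: derivative_eq_intros simp flip: has_real_derivative_iff_has_vector_derivative)
      then have pow: "((\<lambda>s. s ^ (k - 1)) has_integral t ^ k / real k) {0..t}"
        using \<open>k \<ge> 1\<close> by (simp add: power_0_left)
      have "((\<lambda>s. w s - s ^ (k - 1) * h 0) has_integral (G t - t ^ k / real k * h 0)) {0..t}"
        unfolding G_def
        by (intro has_integral_diff integrable_integral w_t has_integral_mult_left pow)
      then have int: "((\<lambda>s. s ^ (k - 1) * (h s - h 0)) has_integral (G t - t ^ k / real k * h 0)) {0..t}"
        by (simp add: w_def algebra_simps)
      have "norm (integral {0..t} (\<lambda>s. s ^ (k - 1) * (h s - h 0)))
          \<le> integral {0..t} (\<lambda>s. t ^ (k - 1) * \<bar>h s - h 0\<bar>)"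
      proof (rule integral_norm_bound_integral)
        show "(\<lambda>s. s ^ (k - 1) * (h s - h 0)) integrable_on {0..t}" using int by blast
        show "(\<lambda>s. t ^ (k - 1) * \<bar>h s - h 0\<bar>) integrable_on {0..t}"
          using set_integrable_abs[OF diff]
          by (intro integrable_on_mult_right) (simp add: set_lebesgue_integral_eq_integral)
        show "norm (s ^ (k - 1) * (h s - h 0)) \<le> t ^ (k - 1) * \<bar>h s - h 0\<bar>" if "s \<in> {0..t}" for s
          using that by (auto simp: abs_mult intro!: mult_right_mono power_mono)
      qed
      then have "\<bar>G t - t ^ k / real k * h 0\<bar> \<le> t ^ (k - 1) * integral {0..t} (\<lambda>s. \<bar>h s - h 0\<bar>)"
        using int by (simp add: integral_unique)
      then have "\<bar>G t - t ^ k / real k * h 0\<bar> / t ^ k \<le> t ^ (k - 1) * integral {0..t} (\<lambda>s. \<bar>h s - h 0\<bar>) / t ^ k"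
        using t by (intro divide_right_mono) auto
      also have "\<dots> = integral {0..t} (\<lambda>s. \<bar>h s - h 0\<bar>) / t"
        using t by (simp add: power_k)
      also have "\<bar>G t - t ^ k / real k * h 0\<bar> / t ^ k = \<bar>(G t - t ^ k / real k * h 0) / t ^ k\<bar>"
        using t by (simp add: abs_divide)
      also have "(G t - t ^ k / real k * h 0) / t ^ k = G t / t ^ k - h 0 / real k"
        using t by (simp add: diff_divide_distrib)
      also have "\<dots> = u t - u 0"
        using t by (simp add: u_def divide_inverse)
      finally show "norm (u t - u 0) \<le> integral {0..t} (\<lambda>s. \<bar>h s - h 0\<bar>) / t" by simp
    qed
    then show ?thesis by (rule LIM_zero_cancel)
  qed
  moreover have cont_pos: "continuous_on {\<epsilon>..T} u" if "\<epsilon> > 0" for \<epsilon>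
  proof -
    have "continuous_on {\<epsilon>..T} (\<lambda>t. G t * inverse (t ^ k))"
      using that by (intro continuous_intros continuous_on_subset[OF G_cont]) auto
    then show ?thesis
      by (rule continuous_on_eq) (use that in \<open>auto simp: u_def\<close>)
  qed
  ultimately have u_cont: "continuous_on {0..T} u"
    unfolding continuous_on_eq_continuous_within
  proof (intro ballI)
    fix x assume lim0: "(u \<longlongrightarrow> u 0) (at_right 0)" and x: "x \<in> {0..T}"
    show "continuous (at x within {0..T}) u"
    proof (cases "x = 0")
      case True
      then show ?thesis using lim0 T by (simp add: continuous_within at_within_Icc_at_right)
    next
      case False
      then have "x > 0" using x by simp
      have "continuous (at x within {x / 2..T}) u"
        using cont_pos[of "x / 2"] x \<open>x > 0\<close> by (simp add: continuous_on_eq_continuous_within)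
      moreover have "at x within {x / 2..T} = at x within {0..T}"
        by (rule at_within_nhd[of x "{x / 2<..}"]) (use \<open>x > 0\<close> in auto)
      ultimately show ?thesis by (simp add: continuous_within)
    qed
  qed
  have "absolutely_continuous_on {\<epsilon>..T} u" if \<epsilon>: "\<epsilon> \<in> {0<..<T}" for \<epsilon>
  proof -
    have "absolutely_continuous_on {\<epsilon>..T} G"
      using \<epsilon> by (intro absolutely_continuous_on_subset_cong[OF G_ac]) auto
    moreover have "absolutely_continuous_on {\<epsilon>..T} (\<lambda>s. inverse (s ^ k))"
      by (rule absolutely_continuous_on_continuous_derivative[where p' = "\<lambda>s. - (inverse (s ^ k) * (real k * s ^ (k - 1)) * inverse (s ^ k))"])
         (use \<epsilon> in \<open>auto intro!: derivative_eq_intros continuous_intros\<close>)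
    moreover have "bounded (G ` {\<epsilon>..T})"
      using \<epsilon> by (intro compact_imp_bounded compact_continuous_image continuous_on_subset[OF G_cont]) auto
    moreover have "bounded ((\<lambda>s. inverse (s ^ k)) ` {\<epsilon>..T})"
      using \<epsilon> by (intro compact_imp_bounded compact_continuous_image continuous_intros) auto
    ultimately have "absolutely_continuous_on {\<epsilon>..T} (\<lambda>s. G s * inverse (s ^ k))"
      by (intro absolutely_continuous_on_mult)
    then show ?thesis
      by (rule absolutely_continuous_on_subset_cong) (use \<epsilon> in \<open>auto simp: u_def\<close>)
  qed
  moreover have "negligible {t \<in> {0<..T}. \<not> (u has_vector_derivative (h t - real k * u t) / t) (at t within {0..T})}"
  proof (rule negligible_subset[OF N], clarify, rule ccontr)
    fix x assume x: "x \<in> {0<..T}" "x \<notin> N"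
      and not: "\<not> (u has_vector_derivative (h x - real k * u x) / x) (at x within {0..T})"
    have "(G has_real_derivative w x) (at x within {0..T})"
      using G_deriv[of x] x by (simp add: has_real_derivative_iff_has_vector_derivative)
    then have "((\<lambda>t. G t * inverse (t ^ k)) has_real_derivative
        w x * inverse (x ^ k) - G x * (inverse (x ^ k) * (real k * x ^ (k - 1)) * inverse (x ^ k))) (at x within {0..T})"
      using x by (auto intro!: derivative_eq_intros)
    moreover have "w x * inverse (x ^ k) - G x * (inverse (x ^ k) * (real k * x ^ (k - 1)) * inverse (x ^ k))
        = (h x - real k * u x) / x"
      using x by (simp add: w_def u_def power_k field_simps)
    ultimately have "((\<lambda>t. G t * inverse (t ^ k)) has_vector_derivative (h x - real k * u x) / x) (at x within {0..T})"
      by (simp add: has_real_derivative_iff_has_vector_derivative)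
    then have "(u has_vector_derivative (h x - real k * u x) / x) (at x within {0..T})"
      by (rule has_vector_derivative_transform_within[where d = x]) (use x in \<open>auto simp: u_def dist_real_def\<close>)
    with not show False by contradiction
  qed
  ultimately have "singular_solution T k h u"
    using u_cont by (simp add: singular_solution_def)
  then show ?thesis by (rule that) (simp add: u_def)
qed

section \<open>The triangular system\<close>

lemma idx_eq_iff: "idx i = idx j \<longleftrightarrow> i = (j :: 'n::{finite,linorder})"
  using strict_mono_idx by (rule strict_mono_eq)

lemma idx_ge_1: "idx (i :: 'n::{finite,linorder}) \<ge> 1"
  using bij_betwE[OF bij_betw_idx] by force

lemma legs_A_diag: "legs_A $ i $ i = real (idx i)"
  by (simp add: legs_A_def)

lemma legs_A_mult_component:
  fixes x :: "real ^ 'n::{finite,linorder}"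
  shows "(legs_A *v x) $ i = real (idx i) * x $ i + (\<Sum>j | idx j < idx i. legs_A $ i $ j * x $ j)"
proof -
  have "(legs_A *v x) $ i = (\<Sum>j\<in>UNIV. legs_A $ i $ j * x $ j)"
    by (simp add: matrix_vector_mult_def)
  also have "\<dots> = (\<Sum>j\<in>insert i {j. idx j < idx i}. legs_A $ i $ j * x $ j)"
    by (rule sum.mono_neutral_right) (auto simp: legs_A_def idx_eq_iff)
  also have "\<dots> = real (idx i) * x $ i + (\<Sum>j | idx j < idx i. legs_A $ i $ j * x $ j)"
    by (subst sum.insert) (auto simp: legs_A_diag)
  finally show ?thesis .
qed

lemma has_vector_derivative_vec_iff:
  fixes c :: "real \<Rightarrow> real ^ 'n"
  shows "(c has_vector_derivative D) F \<longleftrightarrow> (\<forall>i. ((\<lambda>t. c t $ i) has_vector_derivative D $ i) F)"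
proof (intro iffI allI)
  fix i assume "(c has_vector_derivative D) F"
  then show "((\<lambda>t. c t $ i) has_vector_derivative D $ i) F"
    by (rule bounded_linear.has_vector_derivative[OF bounded_linear_vec_nth])
next
  assume "\<forall>i. ((\<lambda>t. c t $ i) has_vector_derivative D $ i) F"
  then have "((\<lambda>t. \<Sum>i\<in>UNIV. c t $ i *\<^sub>R (axis i 1 :: real ^ 'n)) has_vector_derivative (\<Sum>i\<in>UNIV. D $ i *\<^sub>R axis i 1)) F"
    by (intro has_vector_derivative_sum bounded_linear.has_vector_derivative[OF bounded_linear_scaleR_left]) auto
  moreover have expansion: "(\<Sum>i\<in>UNIV. x $ i *\<^sub>R axis i 1) = x" for x :: "real ^ 'n"
    using basis_expansion[of x] by (simp add: scalar_mult_eq_scaleR)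
  ultimately show "(c has_vector_derivative D) F" unfolding expansion by simp
qed

text \<open>
  The right-hand side \<open>h\<close> of the scalar equation for component \<open>i\<close>. It depends only on the components
  with smaller index. The components are indexed functions here, not a vector-valued function, so that
  they can be constructed one at a time.
\<close>

definition legs_row :: "(real \<Rightarrow> real) \<Rightarrow> ('n::{finite,linorder} \<Rightarrow> real \<Rightarrow> real) \<Rightarrow> 'n \<Rightarrow> real \<Rightarrow> real" where
  "legs_row f c i t = legs_B $ i * f t - (\<Sum>j | idx j < idx i. legs_A $ i $ j * c j t)"

lemma AE_lebesgue_on_iff_negligible:
  assumes "S \<in> sets lebesgue"
  shows "(AE x in lebesgue_on S. P x) \<longleftrightarrow> negligible {x \<in> S. \<not> P x}"
proof -
  have "(AE x in lebesgue_on S. P x) \<longleftrightarrow> (AE x in lebesgue. x \<in> S \<longrightarrow> P x)"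
    using assms by (intro AE_restrict_space_iff) simp
  also have "\<dots> \<longleftrightarrow> negligible {x \<in> S. \<not> P x}"
    by (simp add: completion.AE_iff_null_sets negligible_iff_null_sets)
  finally show ?thesis .
qed

lemma legs_solution_iff_rows:
  fixes c :: "real \<Rightarrow> real ^ 'n::{finite,linorder}"
  shows "legs_solution T f c0 c \<longleftrightarrow>
    (\<forall>i. singular_solution T (idx i) (legs_row f (\<lambda>j t. c t $ j) i) (\<lambda>t. c t $ i)) \<and> c 0 = c0"
proof -
  define D where "D t = - (1 / t) *\<^sub>R (legs_A *v c t) + (1 / t) *\<^sub>R (f t *\<^sub>R legs_B)" for t
  define P where "P t i \<longleftrightarrow> ((\<lambda>t. c t $ i) has_vector_derivative
    (legs_row f (\<lambda>j t. c t $ j) i t - real (idx i) * c t $ i) / t) (at t within {0..T})" for t i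
  have comp: "D t $ i = (legs_row f (\<lambda>j t. c t $ j) i t - real (idx i) * c t $ i) / t" for t i
    by (simp add: D_def legs_row_def legs_A_mult_component diff_divide_distrib add_divide_distrib mult.commute)
  have "(c has_vector_derivative D t) (at t within {0..T}) \<longleftrightarrow> (\<forall>i. P t i)" for t
    unfolding has_vector_derivative_vec_iff[of c] comp P_def ..
  then have "(AE t in lebesgue_on {0<..T}. (c has_vector_derivative D t) (at t within {0..T}))
      \<longleftrightarrow> (\<forall>i. AE t in lebesgue_on {0<..T}. P t i)"
    using AE_finite_all[OF finite[of UNIV], where P = P] by simp
  also have "\<dots> \<longleftrightarrow> (\<forall>i. negligible {t \<in> {0<..T}. \<not> P t i})"
    by (simp add: AE_lebesgue_on_iff_negligible)
  finally have ae: "(AE t in lebesgue_on {0<..T}. (c has_vector_derivative D t) (at t within {0..T}))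
      \<longleftrightarrow> (\<forall>i. negligible {t \<in> {0<..T}. \<not> P t i})" .
  have cont: "continuous_on {0..T} c \<longleftrightarrow> (\<forall>i. continuous_on {0..T} (\<lambda>t. c t $ i))"
    using continuous_on_vec_lambda[of "{0..T}" "\<lambda>i t. c t $ i"] by (auto intro: continuous_on_component)
  show ?thesis
    unfolding legs_solution_def singular_solution_def D_def[symmetric] P_def[symmetric]
      ae cont absolutely_continuous_on_vec_iff[of _ c]
    by blast
qed

text \<open>
  The value at \<open>0\<close> that component \<open>i\<close> is forced to take. Beyond the first row the contribution
  \<open>B\<^sub>i f(0)\<close> is cancelled by that of the first component, because the first column of \<open>A\<close> agrees with
  \<open>B\<close> below the diagonal.
\<close>

lemma legs_row_at_0:
  fixes c :: "'n::{finite,linorder} \<Rightarrow> real \<Rightarrow> real"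
  assumes "\<And>j. idx j < idx i \<Longrightarrow> c j 0 = f 0 * e1 $ j"
  shows "legs_row f c i 0 / real (idx i) = f 0 * e1 $ i"
proof (cases "idx i = 1")
  case True
  then have no_row: "{j :: 'n. idx j < idx i} = {}" using idx_ge_1 by (auto simp: not_less Suc_le_eq)
  show ?thesis unfolding legs_row_def no_row by (simp add: True legs_B_def e1_def)
next
  case False
  have "1 \<in> range (idx :: 'n \<Rightarrow> nat)"
    using bij_betw_imp_surj_on[OF bij_betw_idx[where 'n='n]] by (simp add: Suc_le_eq)
  then obtain j0 :: 'n where j0: "idx j0 = 1" by force
  have "(\<Sum>j | idx j < idx i. legs_A $ i $ j * c j 0) = (\<Sum>j | idx j < idx i. if j = j0 then legs_A $ i $ j * f 0 else 0)"
  proof (rule sum.cong)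
    fix j :: 'n assume "j \<in> {j. idx j < idx i}"
    then show "legs_A $ i $ j * c j 0 = (if j = j0 then legs_A $ i $ j * f 0 else 0)"
      using j0 idx_eq_iff[of j j0] by (auto simp: assms e1_def)
  qed simp
  also have "\<dots> = legs_A $ i $ j0 * f 0"
    using False j0 idx_ge_1[of i] by (subst sum.delta) auto
  also have "legs_A $ i $ j0 = legs_B $ i"
    using False j0 idx_ge_1[of i] by (simp add: legs_A_def legs_B_def)
  finally show ?thesis using False by (simp add: legs_row_def e1_def)
qed

context
  fixes T :: real and f :: "real \<Rightarrow> real"
  assumes T: "T > 0" and f: "f absolutely_integrable_on {0..T}" and lp: "lebesgue_point_0 f"
begin

lemma legs_row_regular:
  fixes c :: "'n::{finite,linorder} \<Rightarrow> real \<Rightarrow> real"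
  assumes "\<And>j. idx j < idx i \<Longrightarrow> continuous_on {0..T} (c j)"
  shows "legs_row f c i absolutely_integrable_on {0..T}" "lebesgue_point_0 (legs_row f c i)"
proof -
  have cont: "continuous_on {0..T} (\<lambda>t. \<Sum>j | idx j < idx i. legs_A $ i $ j * c j t)"
    using assms by (intro continuous_intros) auto
  then have g: "(\<lambda>t. \<Sum>j | idx j < idx i. legs_A $ i $ j * c j t) absolutely_integrable_on {0..T}"
    by (rule absolutely_integrable_continuous_real)
  show "legs_row f c i absolutely_integrable_on {0..T}"
    unfolding legs_row_def[abs_def] using f g by (intro set_integral_diff(1) set_integrable_mult_right)
  show "lebesgue_point_0 (legs_row f c i)"
    unfolding legs_row_def[abs_def]
    using T f lp g lebesgue_point_0_continuous[OF T cont] by (rule lebesgue_point_0_linear_combination)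
qed

text \<open>
  The initial values of the two solutions are not assumed equal; this is what also yields
  non-existence for a wrong initial value.
\<close>

lemma legs_solution_unique:
  fixes c d :: "real \<Rightarrow> real ^ 'n::{finite,linorder}"
  assumes c: "legs_solution T f c0 c" and d: "legs_solution T f d0 d" and t: "t \<in> {0..T}"
  shows "c t = d t"
proof -
  have "\<forall>t\<in>{0..T}. c t $ i = d t $ i" for i
  proof (induction "idx i" arbitrary: i rule: less_induct)
    case less
    have c': "singular_solution T (idx i) (legs_row f (\<lambda>j t. c t $ j) i) (\<lambda>t. c t $ i)"
      and d': "singular_solution T (idx i) (legs_row f (\<lambda>j t. d t $ j) i) (\<lambda>t. d t $ i)"
      using c d by (simp_all add: legs_solution_iff_rows)
    have "continuous_on {0..T} (\<lambda>t. c t $ j)" for j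
      using c by (auto simp: legs_solution_iff_rows singular_solution_def)
    then have h: "legs_row f (\<lambda>j t. c t $ j) i absolutely_integrable_on {0..T}"
      by (intro legs_row_regular)
    have eq: "legs_row f (\<lambda>j t. c t $ j) i s = legs_row f (\<lambda>j t. d t $ j) i s" if "s \<in> {0..T}" for s
      using less that by (simp add: legs_row_def)
    show ?case
      using singular_solution_unique[OF T idx_ge_1 h eq c' d'] by blast
  qed
  then show ?thesis using t by (simp add: vec_eq_iff)
qed

lemma legs_solution_exists:
  "\<exists>c :: real \<Rightarrow> real ^ 'n::{finite,linorder}. legs_solution T f (f 0 *\<^sub>R e1) c"
proof -
  have "\<exists>c :: 'n \<Rightarrow> real \<Rightarrow> real. \<forall>i. idx i \<le> n \<longrightarrow>
      singular_solution T (idx i) (legs_row f c i) (c i) \<and> c i 0 = f 0 * e1 $ i" for n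
  proof (induction n)
    case 0
    have "\<not> idx i \<le> 0" for i :: 'n using idx_ge_1[of i] by simp
    then show ?case by blast
  next
    case (Suc n)
    then obtain c :: "'n \<Rightarrow> real \<Rightarrow> real" where
      c: "\<And>i. idx i \<le> n \<Longrightarrow> singular_solution T (idx i) (legs_row f c i) (c i)"
      and c0: "\<And>i. idx i \<le> n \<Longrightarrow> c i 0 = f 0 * e1 $ i" by blast
    show ?case
    proof (cases "\<exists>i :: 'n. idx i = Suc n")
      case False
      then show ?thesis using c c0 by (metis le_SucE)
    next
      case True
      then obtain k :: 'n where k: "idx k = Suc n" by blast
      have "continuous_on {0..T} (c j)" if "idx j < idx k" for j
        using c[of j] that k by (simp add: singular_solution_def)
      note reg = legs_row_regular[of k c, OF this]
      obtain u where u: "singular_solution T (idx k) (legs_row f c k) u"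
        and u0: "u 0 = legs_row f c k 0 / real (idx k)"
        using singular_solution_exists[OF T idx_ge_1 reg] by blast
      \<comment> \<open>Changing component \<open>k\<close> does not affect the rows up to \<open>k\<close>, which only see smaller indices.\<close>
      have same_row: "legs_row f (c(k := u)) i = legs_row f c i" if "idx i \<le> Suc n" for i
        using that k by (intro ext) (auto simp: legs_row_def intro!: sum.cong)
      have "singular_solution T (idx i) (legs_row f (c(k := u)) i) ((c(k := u)) i) \<and> (c(k := u)) i 0 = f 0 * e1 $ i"
        if i: "idx i \<le> Suc n" for i
      proof (cases "i = k")
        case True
        have "u 0 = f 0 * e1 $ k"
          unfolding u0 using c0 k by (intro legs_row_at_0) auto
        then show ?thesis using True u same_row[of k] k by simp
      next
        case False
        then have "idx i \<le> n" using i k idx_eq_iff[of i k] by (simp add: le_Suc_eq)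
        then show ?thesis using False c[of i] c0[of i] same_row[OF i] by simp
      qed
      then show ?thesis by blast
    qed
  qed
  from this[of "CARD('n)"] obtain c :: "'n \<Rightarrow> real \<Rightarrow> real" where
    c: "\<And>i. idx i \<le> CARD('n) \<Longrightarrow> singular_solution T (idx i) (legs_row f c i) (c i) \<and> c i 0 = f 0 * e1 $ i"
    by blast
  have "idx i \<le> CARD('n)" for i :: 'n using bij_betwE[OF bij_betw_idx] by force
  with c have "legs_solution T f (f 0 *\<^sub>R e1) (\<lambda>t. \<chi> i. c i t)"
    by (simp add: legs_solution_iff_rows vec_eq_iff)
  then show ?thesis by blast
qed

end

theorem theorem1:
  fixes T :: real and f :: "real \<Rightarrow> real" and c0 :: "real ^ 'n::{finite,linorder}"
  assumes "T > 0"
    and "f \<in> borel_measurable (lebesgue_on {0..T})"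
    and "integrable (lebesgue_on {0..T}) f"
    and "lebesgue_point_0 f"
  shows "(c0 = f 0 *\<^sub>R e1 \<longrightarrow>
            (\<exists>c. legs_solution T f c0 c) \<and>
            (\<forall>c d. legs_solution T f c0 c \<and> legs_solution T f c0 d \<longrightarrow> (\<forall>t\<in>{0..T}. c t = d t))) \<and>
         (c0 \<noteq> f 0 *\<^sub>R e1 \<longrightarrow> \<not> (\<exists>c. legs_solution T f c0 c))"
proof -
  have f: "f absolutely_integrable_on {0..T}"
    using assms(3) by (simp add: set_integrable_def integrable_restrict_space)
  note unique = legs_solution_unique[OF \<open>T > 0\<close> f \<open>lebesgue_point_0 f\<close>]
  obtain c :: "real \<Rightarrow> real ^ 'n::{finite,linorder}" where c: "legs_solution T f (f 0 *\<^sub>R e1) c"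
    using legs_solution_exists[OF \<open>T > 0\<close> f \<open>lebesgue_point_0 f\<close>] by blast
  have "c0 = f 0 *\<^sub>R e1" if d: "legs_solution T f c0 d" for d :: "real \<Rightarrow> real ^ 'n::{finite,linorder}"
    using unique[OF c d, of 0] c d \<open>T > 0\<close> by (simp add: legs_solution_def)
  then show ?thesis using c unique by blast
qed

end
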